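(* Let $K$ be a field, $S=K[x_1,\ldots,x_n]$, let $\mathcal P$ be a discrete polymatroid of rank $d$ on the ground set $[n]$ with rank function $\rho$, and let $I\subset S$ be the polymatroidal ideal associated with $\mathcal P$. Then \[ I=\bigcap_{\mathfrak p_F\in\operatorname{Ass}(S/I)}\mathfrak p_F^{\,d-\rho([n]\setminus F)} \] is the canonical primary decomposition of $I$.
   Context: For $\mathbf u=(u_1,\dots,u_n)\in\mathbb Z_{\ge0}^n$ write $|\mathbf u|=\sum_i u_i$ and $\mathbf x^{\mathbf u}=x_1^{u_1}\cdots x_n^{u_n}$, and for $F\subset[n]=\{1,\dots,n\}$ write $\mathbf u(F)=\sum_{i\in F}u_i$. A discrete polymatroid on the ground set $[n]$ is a nonempty finite set $\mathcal P\subset\mathbb Z_{\geq0}^n$ such that (1) if $\mathbf u\in\mathcal P$ and $\mathbf v\in\mathbb Z_{\ge 0}^n$ satisfies $\mathbf v\leq\mathbf u$ componentwise, then $\mathbf v\in\mathcal P$; (2) if $\mathbf u,\mathbf v\in\mathcal P$ with $|\mathbf u|<|\mathbf v|$, then there is $\mathbf w\in\mathcal P$ with $\mathbf u<\mathbf w\leq\mathbf u\vee\mathbf v$, where $\mathbf u\vee\mathbf v$ is the componentwise maximum. The set $B(\mathcal P)$ of bases consists of the $\mathbf u\in\mathcal P$ with $|\mathbf u|$ maximal; this maximal value $d$ is the rank of $\mathcal P$. The polymatroidal ideal associated with $\mathcal P$ is the monomial ideal generated by all $\mathbf x^{\mathbf u}$ with $\mathbf u\in B(\mathcal P)$. The (ground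 set) rank function $\rho\colon2^{[n]}\to\mathbb Z_{\geq0}$ is $\rho(F)=\max\{\mathbf u(F):\mathbf u\in B(\mathcal P)\}$ for $F\neq\emptyset$ and $\rho(\emptyset)=0$. For $F\subset[n]$, $\mathfrak p_F$ is the monomial prime ideal generated by the variables $x_i$ with $i\in F$; associated primes of $S/I$, for $I$ a monomial ideal, are of this form. If a monomial ideal $I$ is an intersection of powers (with positive integer exponents; the empty intersection is $S$) of monomial prime ideals, then its canonical primary decomposition is its unique irredundant presentation as such an intersection; the primes occurring in it are exactly those in $\operatorname{Ass}(S/I)$. *)

theory Defs
  imports
    "HOL-Library.Poly_Mapping"
    "HOL-Algebra.Ideal_Product"
    "HOL-Algebra.QuotRing"
    "HOL-Algebra.Module"
begin

text \<open>
  A vector of $\mathbb{Z}_{\ge 0}^n$ is a finitely supported function \<open>u :: nat \<Rightarrow>\<^sub>0 nat\<close> supported in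
  \<open>{1..n}\<close>. The library orders \<^typ>\<open>nat \<Rightarrow>\<^sub>0 nat\<close> lexicographically, so the componentwise order
  and the componentwise maximum are taken on the underlying functions
  \<open>Poly_Mapping.lookup u :: nat \<Rightarrow> nat\<close>.
\<close>

definition exponents :: "nat \<Rightarrow> (nat \<Rightarrow>\<^sub>0 nat) set" where
  "exponents n = {u. Poly_Mapping.keys u \<subseteq> {1..n}}"

definition weight :: "nat set \<Rightarrow> (nat \<Rightarrow>\<^sub>0 nat) \<Rightarrow> nat" where
  "weight F u = (\<Sum>i\<in>F. Poly_Mapping.lookup u i)"

definition discrete_polymatroid :: "nat \<Rightarrow> (nat \<Rightarrow>\<^sub>0 nat) set \<Rightarrow> bool" where
  "discrete_polymatroid n P \<longleftrightarrow>
     P \<noteq> {} \<and> finite P \<and> P \<subseteq> exponents n \<and>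
     (\<forall>u\<in>P. \<forall>v\<in>exponents n. Poly_Mapping.lookup v \<le> Poly_Mapping.lookup u \<longrightarrow> v \<in> P) \<and>
     (\<forall>u\<in>P. \<forall>v\<in>P. weight {1..n} u < weight {1..n} v \<longrightarrow>
        (\<exists>w\<in>P. Poly_Mapping.lookup u < Poly_Mapping.lookup w \<and>
              Poly_Mapping.lookup w \<le> sup (Poly_Mapping.lookup u) (Poly_Mapping.lookup v)))"

definition polymatroid_rank :: "nat \<Rightarrow> (nat \<Rightarrow>\<^sub>0 nat) set \<Rightarrow> nat" where
  "polymatroid_rank n P = Max (weight {1..n} ` P)"

definition bases :: "nat \<Rightarrow> (nat \<Rightarrow>\<^sub>0 nat) set \<Rightarrow> (nat \<Rightarrow>\<^sub>0 nat) set" where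
  "bases n P = {u \<in> P. weight {1..n} u = polymatroid_rank n P}"

definition rank_fun :: "nat \<Rightarrow> (nat \<Rightarrow>\<^sub>0 nat) set \<Rightarrow> nat set \<Rightarrow> nat" where
  "rank_fun n P F = (if F = {} then 0 else Max (weight F ` bases n P))"

text \<open>
  $K[x_1,\dots,x_n]$ is the subring of the polynomials in the variables $x_i$, \<open>i :: nat\<close>, that
  only involve variables with index in \<open>{1..n}\<close>.
\<close>

definition mpoly_ring :: "nat \<Rightarrow> ((nat \<Rightarrow>\<^sub>0 nat) \<Rightarrow>\<^sub>0 'k::field) ring" where
  "mpoly_ring n =
     \<lparr>carrier = {f. Poly_Mapping.keys f \<subseteq> exponents n}, mult = (*), one = 1, zero = 0, add = (+)\<rparr>"

definition monomial :: "(nat \<Rightarrow>\<^sub>0 nat) \<Rightarrow> (nat \<Rightarrow>\<^sub>0 nat) \<Rightarrow>\<^sub>0 'k::field" where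
  "monomial u = Poly_Mapping.single u 1"

definition variable :: "nat \<Rightarrow> (nat \<Rightarrow>\<^sub>0 nat) \<Rightarrow>\<^sub>0 'k::field" where
  "variable i = monomial (Poly_Mapping.single i 1)"

definition polymatroidal_ideal ::
    "nat \<Rightarrow> (nat \<Rightarrow>\<^sub>0 nat) set \<Rightarrow> ((nat \<Rightarrow>\<^sub>0 nat) \<Rightarrow>\<^sub>0 'k::field) set" where
  "polymatroidal_ideal n P = Idl\<^bsub>mpoly_ring n\<^esub> (monomial ` bases n P)"

definition monomial_prime :: "nat \<Rightarrow> nat set \<Rightarrow> ((nat \<Rightarrow>\<^sub>0 nat) \<Rightarrow>\<^sub>0 'k::field) set" where
  "monomial_prime n F = Idl\<^bsub>mpoly_ring n\<^esub> (variable ` F)"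

definition ideal_power :: "('a, 'b) ring_scheme \<Rightarrow> 'a set \<Rightarrow> nat \<Rightarrow> 'a set" where
  "ideal_power R I k = I [^]\<^bsub>ideals_set R\<^esub> k"

definition annihilator :: "('a, 'c) ring_scheme \<Rightarrow> ('a, 'b, 'd) module_scheme \<Rightarrow> 'b \<Rightarrow> 'a set" where
  "annihilator R M m = {a \<in> carrier R. a \<odot>\<^bsub>M\<^esub> m = \<zero>\<^bsub>M\<^esub>}"

definition Ass :: "('a, 'c) ring_scheme \<Rightarrow> ('a, 'b, 'd) module_scheme \<Rightarrow> 'a set set" where
  "Ass R M = {Q. primeideal Q R \<and> (\<exists>m\<in>carrier M. Q = annihilator R M m)}"

definition quot_module :: "('a, 'c) ring_scheme \<Rightarrow> 'a set \<Rightarrow> ('a, 'a set) module" where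
  "quot_module R I =
     \<lparr>carrier = carrier (R Quot I), mult = mult (R Quot I), one = one (R Quot I),
      zero = zero (R Quot I), add = add (R Quot I),
      smult = (\<lambda>a X. (I +>\<^bsub>R\<^esub> a) \<otimes>\<^bsub>R Quot I\<^esub> X)\<rparr>"

text \<open>
  A presentation as an intersection is given by its finite set of components; intersecting with
  the carrier makes the empty intersection the whole ring. Since the components form a set,
  irredundancy says that no component can be omitted.
\<close>

definition irredundant_presentation ::
    "nat \<Rightarrow> ((nat \<Rightarrow>\<^sub>0 nat) \<Rightarrow>\<^sub>0 'k::field) set \<Rightarrow> ((nat \<Rightarrow>\<^sub>0 nat) \<Rightarrow>\<^sub>0 'k) set set \<Rightarrow> bool" where
  "irredundant_presentation n I \<D> \<longleftrightarrow>
     finite \<D> \<and>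
     (\<forall>Q\<in>\<D>. \<exists>F k. F \<subseteq> {1..n} \<and> 0 < k \<and> Q = ideal_power (mpoly_ring n) (monomial_prime n F) k) \<and>
     I = carrier (mpoly_ring n) \<inter> \<Inter>\<D> \<and>
     (\<forall>Q\<in>\<D>. I \<noteq> carrier (mpoly_ring n) \<inter> \<Inter>(\<D> - {Q}))"

definition canonical_primary_decomposition ::
    "nat \<Rightarrow> ((nat \<Rightarrow>\<^sub>0 nat) \<Rightarrow>\<^sub>0 'k::field) set \<Rightarrow> ((nat \<Rightarrow>\<^sub>0 nat) \<Rightarrow>\<^sub>0 'k) set set \<Rightarrow> bool" where
  "canonical_primary_decomposition n I \<D> \<longleftrightarrow>
     irredundant_presentation n I \<D> \<and> (\<forall>\<D>'. irredundant_presentation n I \<D>' \<longrightarrow> \<D>' = \<D>)"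

lemma exponents_add: "u \<in> exponents n \<Longrightarrow> v \<in> exponents n \<Longrightarrow> u + v \<in> exponents n"
  using keys_add[of u v] by (auto simp: exponents_def)

lemma cring_mpoly_ring: "cring (mpoly_ring n :: ((nat \<Rightarrow>\<^sub>0 nat) \<Rightarrow>\<^sub>0 'k::field) ring)"
proof (rule cringI)
  show "abelian_group (mpoly_ring n :: ((nat \<Rightarrow>\<^sub>0 nat) \<Rightarrow>\<^sub>0 'k) ring)"
  proof (rule abelian_groupI)
    fix x :: "(nat \<Rightarrow>\<^sub>0 nat) \<Rightarrow>\<^sub>0 'k" assume "x \<in> carrier (mpoly_ring n)"
    then show "\<exists>y\<in>carrier (mpoly_ring n). y \<oplus>\<^bsub>mpoly_ring n\<^esub> x = \<zero>\<^bsub>mpoly_ring n\<^esub>"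
      by (intro bexI[of _ "- x"]) (auto simp: mpoly_ring_def)
  qed (use keys_add in \<open>fastforce simp: mpoly_ring_def algebra_simps\<close>)+
  show "comm_monoid (mpoly_ring n :: ((nat \<Rightarrow>\<^sub>0 nat) \<Rightarrow>\<^sub>0 'k) ring)"
  proof (rule comm_monoidI)
    fix x y :: "(nat \<Rightarrow>\<^sub>0 nat) \<Rightarrow>\<^sub>0 'k"
    assume "x \<in> carrier (mpoly_ring n)" "y \<in> carrier (mpoly_ring n)"
    then show "x \<otimes>\<^bsub>mpoly_ring n\<^esub> y \<in> carrier (mpoly_ring n)"
      using keys_mult[of x y] by (fastforce simp: mpoly_ring_def intro: exponents_add)
  qed (auto simp: mpoly_ring_def algebra_simps exponents_def)
qed (auto simp: mpoly_ring_def algebra_simps)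

lemma module_quot_module:
  fixes R (structure)
  assumes "cring R" "ideal I R"
  shows "module R (quot_module R I)"
proof -
  interpret cring R by fact
  interpret ideal I R by fact
  interpret Q: cring "R Quot I"
    by (rule quotient_is_cring) fact
  interpret h: ring_hom_ring R "R Quot I" "(+>) I"
    by (rule rcos_ring_hom_ring)
  show ?thesis
  proof (rule moduleI)
    show "abelian_group (quot_module R I)"
    proof (rule abelian_groupI)
      fix X assume "X \<in> carrier (quot_module R I)"
      then show "\<exists>Y\<in>carrier (quot_module R I). Y \<oplus>\<^bsub>quot_module R I\<^esub> X = \<zero>\<^bsub>quot_module R I\<^esub>"
        using Q.l_neg Q.a_inv_closed by (auto simp: quot_module_def)
    qed (simp_all add: quot_module_def Q.add.m_assoc, simp add: Q.add.m_comm)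
  qed (auto simp: quot_module_def Q.l_distr Q.r_distr Q.m_assoc \<open>cring R\<close>)
qed

end

theory Submission
  imports Defs
begin

text \<open>
  A monomial ideal is determined by the exponents of its monomials, and the \<open>k\<close>-th power of the
  monomial prime of \<open>F\<close> consists of the polynomials whose exponents satisfy \<open>w(F) \<ge> k\<close>
  (\<open>ideal_power_monomial_prime\<close>). So a presentation of \<open>I\<close> as an intersection of such powers
  is a system of inequalities \<open>w(F) \<ge> k\<close> that cuts out the exponents of \<open>I\<close>, and the theorem splits
  into a statement on polymatroids and one on such systems.

  On polymatroids: \<open>w\<close> dominates a base if and only if \<open>w(F) \<ge> d - \<rho>([n] - F)\<close> for all \<open>F\<close>
  (\<open>dominates_base_iff\<close>). This is the rank formula
  \<open>max {|u| : u \<in> P, u \<le> w} = min {w(F) + \<rho>([n] - F) : F \<subseteq> [n]}\<close>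
  in the case where the maximum is \<open>d\<close>. Its proof takes a maximal
  \<open>u \<le> w\<close> in the polymatroid; the directions in which \<open>u\<close> cannot grow form a set on which the weight
  of \<open>u\<close> is the largest possible (\<open>saturated_set_weight_le\<close>).

  On systems: if the system is irredundant, each of its inequalities \<open>(F, k)\<close> has a corner, that is, a
  point \<open>u\<close> outside the region such that \<open>u + e\<^sub>i\<close> is inside for all \<open>i \<in> F\<close>, with \<open>u(F) = k - 1\<close> and with
  arbitrarily large coordinates outside \<open>F\<close> (\<open>irredundant_corner\<close>). Conversely, such a corner forces an
  inequality for the same set \<open>F\<close> and with a bound above \<open>u(F)\<close> in every system for the same region
  (\<open>corner_constraint\<close>), provided the coordinates outside \<open>F\<close> are large enough. Corners
  therefore show that the irredundant system is unique
  (\<open>irredundant_constraints_unique\<close>) and, since they are essentially the monomials whose annihilator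
  modulo \<open>I\<close> is the prime of \<open>F\<close>, that its sets \<open>F\<close> are those of the associated primes (\<open>Ass_region_iff\<close>).

  Thus an irredundant subsystem of the inequalities \<open>w(F) \<ge> d - \<rho>([n] - F)\<close> is indexed by the associated
  primes, and it is the canonical primary decomposition.
\<close>

section \<open>Exponent vectors\<close>

abbreviation lookup where "lookup \<equiv> Poly_Mapping.lookup"
abbreviation unit_vector :: "nat \<Rightarrow> (nat \<Rightarrow>\<^sub>0 nat)" where "unit_vector i \<equiv> Poly_Mapping.single i 1"

lemma lookup_add_single:
  "lookup (u + Poly_Mapping.single i c) j = lookup u j + (if j = i then c else 0)"
  by (auto simp: lookup_add lookup_single)

lemma lookup_outside_exponents: "u \<in> exponents n \<Longrightarrow> i \<notin> {1..n} \<Longrightarrow> lookup u i = 0"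
  by (auto simp: exponents_def in_keys_iff)

lemma exponents_iff: "u \<in> exponents n \<longleftrightarrow> (\<forall>i. i \<notin> {1..n} \<longrightarrow> lookup u i = 0)"
  by (auto simp: exponents_def in_keys_iff subset_iff)

lemma unit_vector_exponents: "i \<in> {1..n} \<Longrightarrow> unit_vector i \<in> exponents n"
  by (auto simp: exponents_def)

lemma exponents_downward:
  "u \<in> exponents n \<Longrightarrow> lookup v \<le> lookup u \<Longrightarrow> v \<in> exponents n"
  unfolding exponents_iff le_fun_def by (metis le_zero_eq)

lemma exponents_of_function:
  assumes "\<And>i. i \<notin> {1..n} \<Longrightarrow> g i = 0"
  shows "\<exists>u\<in>exponents n. lookup u = g"
proof -
  have "{i. g i \<noteq> 0} \<subseteq> {1..n}"
    using assms by (metis (mono_tags, lifting) mem_Collect_eq subsetI)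
  then have "finite {i. g i \<noteq> 0}" by (rule finite_subset) simp
  then have "lookup (Abs_poly_mapping g) = g" by simp
  moreover from this have "Abs_poly_mapping g \<in> exponents n"
    using assms by (simp add: exponents_iff)
  ultimately show ?thesis by blast
qed

lemma weight_add: "weight F (u + v) = weight F u + weight F v"
  by (simp add: weight_def lookup_add sum.distrib)

lemma weight_single: "finite F \<Longrightarrow> weight F (Poly_Mapping.single i c) = (if i \<in> F then c else 0)"
  by (auto simp: weight_def lookup_single when_def)

lemma weight_eq_0_iff: "finite F \<Longrightarrow> weight F u = 0 \<longleftrightarrow> (\<forall>i\<in>F. lookup u i = 0)"
  by (simp add: weight_def)

lemma weight_mono: "lookup u \<le> lookup v \<Longrightarrow> weight F u \<le> weight F v"
  by (simp add: weight_def le_fun_def sum_mono)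

lemma weight_split: "F \<subseteq> {1..n} \<Longrightarrow> weight {1..n} u = weight F u + weight ({1..n} - F) u"
  unfolding weight_def by (metis add.commute finite_atLeastAtMost sum.subset_diff)

lemma weight_less:
  assumes "v \<in> exponents n" "lookup u < lookup v"
  shows "weight {1..n} u < weight {1..n} v"
proof -
  obtain i where i: "lookup u i < lookup v i"
    using assms(2) by (auto simp: Orderings.less_fun_def le_fun_def not_le)
  then have "i \<in> {1..n}" using lookup_outside_exponents[OF assms(1)] by fastforce
  then show ?thesis
    unfolding weight_def using assms(2) i
    by (intro sum_strict_mono_ex1) (auto simp: Orderings.less_fun_def le_fun_def)
qed

lemma exponents_minus_unit_vector:
  assumes "w \<in> exponents n" "lookup w i \<noteq> 0"
  obtains v where "v \<in> exponents n" "w = v + unit_vector i"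
proof
  show "w - unit_vector i \<in> exponents n"
    by (rule exponents_downward[OF assms(1)]) (simp add: le_fun_def lookup_minus)
  show "w = (w - unit_vector i) + unit_vector i"
    by (rule poly_mapping_eqI)
      (use assms(2) in \<open>auto simp: lookup_add lookup_minus lookup_single when_def\<close>)
qed

lemma finite_ex_maximal:
  fixes f :: "'a \<Rightarrow> nat"
  assumes "finite A" "A \<noteq> {}"
  shows "\<exists>x\<in>A. \<forall>y\<in>A. f y \<le> f x"
proof -
  have "Max (f ` A) \<in> f ` A" using assms by (intro Max_in) auto
  then obtain x where "x \<in> A" "f x = Max (f ` A)" by force
  with assms show ?thesis by (intro bexI[of _ x]) auto
qed

section \<open>Discrete polymatroids and their rank function\<close>

context
  fixes n :: nat and P :: "(nat \<Rightarrow>\<^sub>0 nat) set"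
  assumes P: "discrete_polymatroid n P"
begin

lemma polymatroid_finite: "finite P" and polymatroid_nonempty: "P \<noteq> {}"
  and polymatroid_exponents: "u \<in> P \<Longrightarrow> u \<in> exponents n"
  using P by (auto simp: discrete_polymatroid_def)

lemma polymatroid_downward: "u \<in> P \<Longrightarrow> lookup v \<le> lookup u \<Longrightarrow> v \<in> P"
  using P exponents_downward[OF polymatroid_exponents] unfolding discrete_polymatroid_def by blast

lemma polymatroid_augment:
  assumes "u \<in> P" "v \<in> P" "weight {1..n} u < weight {1..n} v"
  obtains w where "w \<in> P" "lookup u < lookup w" "\<And>i. lookup w i \<le> max (lookup u i) (lookup v i)"
proof -
  obtain w where "w \<in> P" "lookup u < lookup w" "lookup w \<le> sup (lookup u) (lookup v)"
    using P assms unfolding discrete_polymatroid_def by blast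
  with that show ?thesis by (auto simp: le_fun_def sup_nat_def)
qed

lemma weight_le_rank: "u \<in> P \<Longrightarrow> weight {1..n} u \<le> polymatroid_rank n P"
  unfolding polymatroid_rank_def using polymatroid_finite by auto

lemma bases_nonempty: "bases n P \<noteq> {}"
proof -
  have "polymatroid_rank n P \<in> weight {1..n} ` P"
    unfolding polymatroid_rank_def using polymatroid_finite polymatroid_nonempty
    by (intro Max_in) auto
  then show ?thesis by (auto simp: bases_def)
qed

lemma finite_bases: "finite (bases n P)"
  using polymatroid_finite by (simp add: bases_def)

lemma weight_base_le_rank_fun:
  assumes "b \<in> bases n P"
  shows "weight F b \<le> rank_fun n P F"
  using assms finite_bases by (auto simp: rank_fun_def weight_def)

text \<open>
  The directions in which \<open>u\<close> cannot grow inside the polymatroid form a set \<open>T\<close> on which \<open>u\<close> has the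
  largest possible weight. Otherwise, some \<open>v\<close> has larger weight on \<open>T\<close>, and the restriction of \<open>u\<close> to \<open>T\<close>
  can be augmented towards the restriction of \<open>v\<close>, in a direction \<open>i \<in> T\<close>. Take \<open>z\<close> of maximal weight
  in the polymatroid between that augmented vector and \<open>u + e\<^sub>i\<close>. As \<open>u + e\<^sub>i\<close> is
  not in the polymatroid, \<open>z\<close> is smaller in some coordinate \<open>j\<close>, where \<open>j \<notin> T\<close>. So \<open>u + e\<^sub>j\<close> is in the
  polymatroid, and augmenting \<open>z\<close> towards it contradicts the maximality of \<open>z\<close>.
\<close>

lemma saturated_set_weight_le:
  assumes "u \<in> P" "v \<in> P"
  defines "T \<equiv> {i \<in> {1..n}. u + unit_vector i \<notin> P}"
  shows "weight T v \<le> weight T u"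
proof (rule ccontr)
  assume "\<not> weight T v \<le> weight T u"
  then have less: "weight T u < weight T v" by simp
  have T: "T \<subseteq> {1..n}" by (auto simp: T_def)
  obtain u' where u': "u' \<in> exponents n" "lookup u' = (\<lambda>i. if i \<in> T then lookup u i else 0)"
  proof -
    have "\<exists>u'\<in>exponents n. lookup u' = (\<lambda>i. if i \<in> T then lookup u i else 0)"
      by (rule exponents_of_function) (use T in auto)
    then show ?thesis using that by blast
  qed
  obtain v' where v': "v' \<in> exponents n" "lookup v' = (\<lambda>i. if i \<in> T then lookup v i else 0)"
  proof -
    have "\<exists>v'\<in>exponents n. lookup v' = (\<lambda>i. if i \<in> T then lookup v i else 0)"
      by (rule exponents_of_function) (use T in auto)
    then show ?thesis using that by blast
  qed
  have restr: "weight {1..n} u' = weight T u" "weight {1..n} v' = weight T v"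
    using T by (auto simp: weight_def u'(2) v'(2) sum.If_cases Int_absorb1)
  have "u' \<in> P" by (rule polymatroid_downward[OF assms(1)]) (simp add: le_fun_def u'(2))
  moreover have "v' \<in> P"
    by (rule polymatroid_downward[OF assms(2)]) (simp add: le_fun_def v'(2))
  ultimately obtain x where x: "x \<in> P" "lookup u' < lookup x"
    and x_le: "\<And>i. lookup x i \<le> max (lookup u' i) (lookup v' i)"
    using polymatroid_augment[of u' v'] less restr by metis
  obtain i where i: "lookup u' i < lookup x i"
    using x(2) by (auto simp: Orderings.less_fun_def le_fun_def not_le)
  then have iT: "i \<in> T" using x_le[of i] by (auto simp: u'(2) v'(2) split: if_splits)
  let ?y = "u + unit_vector i"
  let ?A = "{z \<in> P. lookup (u' + unit_vector i) \<le> lookup z \<and> lookup z \<le> lookup ?y}"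
  have "u' + unit_vector i \<in> P"
  proof (rule polymatroid_downward[OF x(1)])
    show "lookup (u' + unit_vector i) \<le> lookup x"
      using x(2) i by (auto simp: le_fun_def Orderings.less_fun_def lookup_add_single)
  qed
  then have "u' + unit_vector i \<in> ?A"
    by (auto simp: le_fun_def lookup_add_single u'(2))
  then obtain z where z: "z \<in> ?A"
    and max: "\<And>y. y \<in> ?A \<Longrightarrow> weight {1..n} y \<le> weight {1..n} z"
  proof -
    have "\<exists>z\<in>?A. \<forall>y\<in>?A. weight {1..n} y \<le> weight {1..n} z"
      using polymatroid_finite \<open>u' + unit_vector i \<in> ?A\<close> by (intro finite_ex_maximal) auto
    then show ?thesis using that by blast
  qed
  have "?y \<notin> P" using iT by (simp add: T_def)
  with z have "lookup z \<noteq> lookup ?y" by (metis (no_types, lifting) mem_Collect_eq poly_mapping_eq_iff)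
  with z have zy: "lookup z < lookup ?y" by (intro order.not_eq_order_implies_strict) auto
  then obtain j where j: "lookup z j < lookup ?y j"
    by (auto simp: Orderings.less_fun_def le_fun_def not_le)
  have y_exp: "?y \<in> exponents n"
    using iT T assms(1) by (intro exponents_add unit_vector_exponents polymatroid_exponents) auto
  have "lookup ?y j \<noteq> 0" using j by simp
  then have "j \<in> {1..n}" using lookup_outside_exponents[OF y_exp] by metis
  moreover have "j \<notin> T"
  proof
    assume "j \<in> T"
    have "lookup (u' + unit_vector i) j \<le> lookup z j" using z by (auto simp: le_fun_def)
    with j \<open>j \<in> T\<close> show False by (auto simp: u'(2) lookup_add_single split: if_splits)
  qed
  ultimately have uj: "u + unit_vector j \<in> P" by (simp add: T_def)
  have "weight {1..n} z < weight {1..n} ?y" using zy y_exp weight_less by blast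
  also have "\<dots> = weight {1..n} (u + unit_vector j)"
    using iT T \<open>j \<in> {1..n}\<close> by (auto simp: weight_add weight_single)
  finally obtain w where w: "w \<in> P" "lookup z < lookup w"
    and w_le: "\<And>l. lookup w l \<le> max (lookup z l) (lookup (u + unit_vector j) l)"
    using polymatroid_augment[of z "u + unit_vector j"] uj z by auto
  \<comment> \<open>Cutting \<open>w\<close> back below \<open>u + e\<^sub>i\<close> still leaves something strictly above \<open>z\<close>: the only coordinate
      where \<open>w\<close> can exceed \<open>u + e\<^sub>i\<close> is \<open>j\<close>, and there \<open>z\<close> lies below \<open>u + e\<^sub>i\<close>.\<close>
  obtain w' where w': "w' \<in> exponents n" "lookup w' = (\<lambda>l. min (lookup w l) (lookup ?y l))"
  proof -
    have "\<exists>w'\<in>exponents n. lookup w' = (\<lambda>l. min (lookup w l) (lookup ?y l))"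
    proof (rule exponents_of_function)
      show "min (lookup w l) (lookup ?y l) = 0" if "l \<notin> {1..n}" for l
        using lookup_outside_exponents[OF polymatroid_exponents[OF w(1)] that] by linarith
    qed
    then show ?thesis using that by blast
  qed
  have "w' \<in> P" by (rule polymatroid_downward[OF w(1)]) (simp add: le_fun_def w'(2))
  have zw': "lookup z \<le> lookup w'" using w(2) zy by (auto simp: w'(2) le_fun_def Orderings.less_fun_def)
  obtain l where l: "lookup z l < lookup w l"
    using w(2) by (auto simp: Orderings.less_fun_def le_fun_def not_le)
  have "lookup z l < lookup ?y l"
  proof (cases "l = j")
    case False
    with w_le[of l] l show ?thesis by (auto simp: lookup_add_single)
  qed (use j in simp)
  then have "lookup z l < lookup w' l" using l by (simp add: w'(2))
  with zw' have "lookup z < lookup w'" by (auto simp: Orderings.less_fun_def le_fun_def not_le)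
  then have z_less: "weight {1..n} z < weight {1..n} w'" by (rule weight_less[OF w'(1)])
  have "w' \<in> ?A"
  proof -
    have "lookup (u' + unit_vector i) \<le> lookup z" using z by blast
    then have "lookup (u' + unit_vector i) \<le> lookup w'" using zw' by (rule order_trans)
    moreover have "lookup w' \<le> lookup ?y" by (simp add: le_fun_def w'(2))
    ultimately show ?thesis using \<open>w' \<in> P\<close> by blast
  qed
  then have "weight {1..n} w' \<le> weight {1..n} z" by (rule max)
  with z_less show False by linarith
qed

lemma rank_fun_saturated_set_le:
  assumes "u \<in> P"
  shows "rank_fun n P {i \<in> {1..n}. u + unit_vector i \<notin> P}
    \<le> weight {i \<in> {1..n}. u + unit_vector i \<notin> P} u"
    (is "rank_fun n P ?T \<le> _")
proof (cases "?T = {}")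
  case False
  have "Max (weight ?T ` bases n P) \<le> weight ?T u"
  proof (rule Max.boundedI)
    show "x \<le> weight ?T u" if "x \<in> weight ?T ` bases n P" for x
    proof -
      obtain b where "b \<in> P" "x = weight ?T b" using \<open>x \<in> _\<close> by (auto simp: bases_def)
      then show ?thesis using saturated_set_weight_le[OF assms, of b] by simp
    qed
  qed (use finite_bases bases_nonempty in blast)+
  with False show ?thesis by (simp only: rank_fun_def if_False)
next
  case True
  then show ?thesis by (simp only: rank_fun_def if_True refl le0)
qed

text \<open>
  The monomials of the polymatroidal ideal, described by linear inequalities. A base \<open>b\<close> loses at most
  \<open>\<rho>([n] - F)\<close> of its weight \<open>d\<close> outside \<open>F\<close>, which gives the inequalities. Conversely, a maximal \<open>u\<close> in the
  polymatroid below \<open>w\<close> agrees with \<open>w\<close> outside the set \<open>T\<close> of directions in which \<open>u\<close> cannot grow, and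
  \<open>u(T) \<ge> \<rho>(T)\<close>, so the inequality for \<open>F = [n] - T\<close> forces \<open>u\<close> to have full weight.
\<close>

lemma dominates_base_iff:
  assumes w: "w \<in> exponents n"
  shows "(\<exists>b\<in>bases n P. lookup b \<le> lookup w) \<longleftrightarrow>
     (\<forall>F\<subseteq>{1..n}. polymatroid_rank n P - rank_fun n P ({1..n} - F) \<le> weight F w)"
proof (intro iffI allI impI)
  fix F assume F: "F \<subseteq> {1..n}" and "\<exists>b\<in>bases n P. lookup b \<le> lookup w"
  then obtain b where b: "b \<in> bases n P" "lookup b \<le> lookup w" by blast
  have "polymatroid_rank n P = weight F b + weight ({1..n} - F) b"
    using b(1) weight_split[OF F, of b] by (simp add: bases_def)
  also have "\<dots> \<le> weight F w + rank_fun n P ({1..n} - F)"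
    by (intro add_mono weight_mono weight_base_le_rank_fun b)
  finally show "polymatroid_rank n P - rank_fun n P ({1..n} - F) \<le> weight F w" by linarith
next
  assume ineqs: "\<forall>F\<subseteq>{1..n}. polymatroid_rank n P - rank_fun n P ({1..n} - F) \<le> weight F w"
  obtain p where "p \<in> P" using polymatroid_nonempty by blast
  then have "0 \<in> P" by (rule polymatroid_downward) (simp add: le_fun_def)
  then have "{u \<in> P. lookup u \<le> lookup w} \<noteq> {}" by (auto simp: le_fun_def)
  then obtain u where u: "u \<in> P" "lookup u \<le> lookup w"
    and max: "\<And>y. y \<in> P \<Longrightarrow> lookup y \<le> lookup w \<Longrightarrow> weight {1..n} y \<le> weight {1..n} u"
  proof -
    have "\<exists>u\<in>{u \<in> P. lookup u \<le> lookup w}. \<forall>y\<in>{u \<in> P. lookup u \<le> lookup w}.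
        weight {1..n} y \<le> weight {1..n} u"
      using polymatroid_finite \<open>{u \<in> P. lookup u \<le> lookup w} \<noteq> {}\<close>
      by (intro finite_ex_maximal) auto
    then show ?thesis using that by blast
  qed
  define T where "T = {i \<in> {1..n}. u + unit_vector i \<notin> P}"
  have T: "T \<subseteq> {1..n}" by (auto simp: T_def)
  have eq: "lookup u i = lookup w i" if i: "i \<in> {1..n} - T" for i
  proof (rule ccontr)
    assume "lookup u i \<noteq> lookup w i"
    with u(2) have "lookup (u + unit_vector i) \<le> lookup w"
      by (auto simp: le_fun_def lookup_add_single le_neq_implies_less Suc_leI)
    with max[of "u + unit_vector i"] i show False
      by (simp add: T_def weight_add weight_single)
  qed
  have "polymatroid_rank n P - rank_fun n P T \<le> weight ({1..n} - T) w"
    using ineqs[rule_format, of "{1..n} - T"] T by (simp add: double_diff)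
  also have "\<dots> = weight ({1..n} - T) u" using eq by (simp add: weight_def)
  finally have "polymatroid_rank n P \<le> weight {1..n} u"
    using rank_fun_saturated_set_le[OF u(1)] weight_split[OF T, of u] by (simp add: T_def)
  then have "u \<in> bases n P" using u(1) weight_le_rank by (simp add: bases_def antisym)
  with u(2) show "\<exists>b\<in>bases n P. lookup b \<le> lookup w" by blast
qed

end

section \<open>Irredundant systems of constraints\<close>

text \<open>
  A pair \<open>(F, k)\<close> stands for the constraint \<open>w(F) \<ge> k\<close>, which describes the exponents of the monomials
  in the \<open>k\<close>-th power of the monomial prime of \<open>F\<close>. Intersections of such powers thus become
  systems of constraints on exponent vectors.
\<close>

definition region :: "nat \<Rightarrow> (nat set \<times> nat) set \<Rightarrow> (nat \<Rightarrow>\<^sub>0 nat) set" where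
  "region n C = {w \<in> exponents n. \<forall>(F, k)\<in>C. k \<le> weight F w}"

definition irredundant_constraints :: "nat \<Rightarrow> (nat set \<times> nat) set \<Rightarrow> bool" where
  "irredundant_constraints n C \<longleftrightarrow> (\<forall>c\<in>C. region n (C - {c}) \<noteq> region n C)"

lemma regionI: "w \<in> exponents n \<Longrightarrow> (\<And>F k. (F, k) \<in> C \<Longrightarrow> k \<le> weight F w) \<Longrightarrow> w \<in> region n C"
  by (auto simp: region_def)

lemma regionD:
  assumes "w \<in> region n C"
  shows "w \<in> exponents n" "(F, k) \<in> C \<Longrightarrow> k \<le> weight F w"
  using assms by (auto simp: region_def)

lemma region_add:
  assumes "w \<in> region n C" "v \<in> exponents n"
  shows "w + v \<in> region n C"
  using regionD[OF assms(1)] assms(2)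
  by (intro regionI exponents_add) (auto simp: weight_add intro: trans_le_add1)

lemma region_antimono: "C \<subseteq> D \<Longrightarrow> region n D \<subseteq> region n C"
  by (auto simp: region_def)

lemma ex_irredundant_subset:
  assumes "finite A"
  shows "\<exists>C\<subseteq>A. region n C = region n A \<and> irredundant_constraints n C"
  using assms
proof (induction A rule: finite_psubset_induct)
  case (psubset A)
  show ?case
  proof (cases "irredundant_constraints n A")
    case False
    then obtain c where "c \<in> A" "region n (A - {c}) = region n A"
      by (auto simp: irredundant_constraints_def)
    with psubset.IH[of "A - {c}"] show ?thesis by blast
  qed blast
qed

text \<open>
  Each constraint \<open>(F, k)\<close> of an irredundant system has a point \<open>u\<close> that fails it by exactly one and
  satisfies all the others. A point that witnesses irredundancy can be raised: inside \<open>F\<close> until only one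
  unit is missing, and outside \<open>F\<close> above any given bound \<open>N\<close>, because the constraint \<open>(F, k)\<close> does not see
  these coordinates. In terms of ideals, \<open>x\<^sup>u\<close> has the prime of \<open>F\<close> as its annihilator modulo the
  intersection.
\<close>

lemma irredundant_corner:
  assumes valid: "C \<subseteq> Pow {1..n} \<times> {0<..}" and irr: "irredundant_constraints n C"
    and nonempty: "region n C \<noteq> {}" and c: "(F, k) \<in> C"
  obtains u where "u \<in> exponents n" "weight F u + 1 = k" "\<And>j. j \<in> {1..n} - F \<Longrightarrow> N \<le> lookup u j"
    "\<And>i. i \<in> F \<Longrightarrow> u + unit_vector i \<in> region n C"
proof -
  have F: "F \<subseteq> {1..n}" "0 < k" using valid c by auto
  then have finF: "finite F" using finite_subset by blast
  \<comment> \<open>For \<open>F = {}\<close> the constraint would be \<open>0 \<ge> k > 0\<close>, which no point satisfies.\<close>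
  have "F \<noteq> {}" using nonempty regionD(2)[OF _ c] F(2) by (auto simp: weight_def)
  then obtain i0 where i0: "i0 \<in> F" by blast
  have "region n C \<subset> region n (C - {(F, k)})"
    using irr c region_antimono[of "C - {(F, k)}" C n] by (auto simp: irredundant_constraints_def)
  then obtain v where v: "v \<in> region n (C - {(F, k)})" "v \<notin> region n C" by blast
  have v_exp: "v \<in> exponents n" by (rule regionD(1)[OF v(1)])
  have v_less: "weight F v < k"
  proof (rule ccontr)
    assume "\<not> weight F v < k"
    with v(1) have "v \<in> region n C" by (auto simp: region_def)
    with v(2) show False by contradiction
  qed
  define g where "g i = lookup v i + (if i = i0 then k - 1 - weight F v else 0)
      + (if i \<in> {1..n} - F then N else 0)" for i
  have "\<exists>u\<in>exponents n. lookup u = g"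
  proof (rule exponents_of_function)
    show "g i = 0" if "i \<notin> {1..n}" for i
      using that i0 F(1) lookup_outside_exponents[OF v_exp that] by (auto simp: g_def)
  qed
  then obtain u where u: "u \<in> exponents n" "lookup u = g" by blast
  have "weight F u = (\<Sum>i\<in>F. lookup v i + (if i = i0 then k - 1 - weight F v else 0))"
    unfolding weight_def u(2) by (intro sum.cong) (auto simp: g_def weight_def)
  also have "\<dots> = weight F v + (k - 1 - weight F v)"
  proof -
    have "(\<Sum>i\<in>F. if i = i0 then k - 1 - weight F v else 0) = k - 1 - weight F v"
      using finF i0 by simp
    then show ?thesis by (simp only: sum.distrib weight_def)
  qed
  finally have weight_u: "weight F u + 1 = k" using v_less by simp
  have vu: "lookup v \<le> lookup u" by (simp add: u(2) g_def le_fun_def)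
  show ?thesis
  proof (rule that[OF u(1) weight_u])
    show "N \<le> lookup u j" if "j \<in> {1..n} - F" for j
      using that by (simp add: u(2) g_def)
    show "u + unit_vector i \<in> region n C" if i: "i \<in> F" for i
    proof (rule regionI)
      show "u + unit_vector i \<in> exponents n"
        using u(1) i F(1) by (intro exponents_add unit_vector_exponents) auto
      fix G l assume G: "(G, l) \<in> C"
      show "l \<le> weight G (u + unit_vector i)"
      proof (cases "(G, l) = (F, k)")
        case True
        then show ?thesis using weight_u i finF by (simp add: weight_add weight_single)
      next
        case False
        then have "l \<le> weight G v" using G by (intro regionD(2)[OF v(1)]) auto
        also have "\<dots> \<le> weight G u" by (rule weight_mono[OF vu])
        finally show ?thesis by (simp add: weight_add)
      qed
    qed
  qed
qed

text \<open>
  A corner in direction \<open>F\<close> with large coordinates outside \<open>F\<close> detects \<open>F\<close> in the system: a violated constraint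
  \<open>(G, l)\<close> has \<open>G \<subseteq> F\<close>, because a single coordinate outside \<open>F\<close> would already satisfy it, and
  \<open>F \<subseteq> G\<close>, because one step in any direction of \<open>F\<close> repairs it.
\<close>

lemma corner_constraint:
  assumes valid: "C \<subseteq> Pow {1..n} \<times> {0<..}"
    and u: "u \<in> exponents n" "u \<notin> region n C"
    and shift: "\<And>i. i \<in> F \<Longrightarrow> u + unit_vector i \<in> region n C"
    and large: "\<And>j G l. j \<in> {1..n} - F \<Longrightarrow> (G, l) \<in> C \<Longrightarrow> l \<le> lookup u j"
  obtains l where "(F, l) \<in> C" "weight F u < l"
proof -
  obtain G l where G: "(G, l) \<in> C" "weight G u < l"
    using u by (auto simp: region_def not_le)
  then have Gn: "G \<subseteq> {1..n}" and finG: "finite G"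
    using valid finite_subset[of G "{1..n}"] by auto
  have "G \<subseteq> F"
  proof
    fix j assume j: "j \<in> G"
    have "lookup u j \<le> weight G u"
      unfolding weight_def using finG j by (intro member_le_sum) auto
    with G large[of j G l] j Gn show "j \<in> F" by fastforce
  qed
  moreover have "F \<subseteq> G"
  proof
    fix i assume "i \<in> F"
    then have "l \<le> weight G (u + unit_vector i)" using shift G(1) by (blast dest: regionD(2))
    with G(2) finG show "i \<in> G" by (auto simp: weight_add weight_single split: if_splits)
  qed
  ultimately have "G = F" by blast
  with that G show ?thesis by blast
qed

lemma constraint_bound:
  assumes "finite (C :: (nat set \<times> nat) set)"
  obtains N where "\<And>G l. (G, l) \<in> C \<Longrightarrow> l \<le> N"
proof -
  have "finite (snd ` C)" using assms by simp
  then obtain N where "\<forall>l\<in>snd ` C. l \<le> N" using finite_nat_set_iff_bounded_le by blast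
  then show ?thesis using that by force
qed

lemma irredundant_constraint_dominated:
  assumes valid: "C \<subseteq> Pow {1..n} \<times> {0<..}" "D \<subseteq> Pow {1..n} \<times> {0<..}"
    and fin: "finite D" and irr: "irredundant_constraints n C"
    and eq: "region n C = region n D" "region n C \<noteq> {}" and c: "(F, k) \<in> C"
  obtains l where "(F, l) \<in> D" "k \<le> l"
proof -
  obtain N where N: "\<And>G l. (G, l) \<in> D \<Longrightarrow> l \<le> N"
    using constraint_bound[OF fin] by blast
  obtain u where u: "u \<in> exponents n" "weight F u + 1 = k"
    "\<And>j. j \<in> {1..n} - F \<Longrightarrow> N \<le> lookup u j"
    "\<And>i. i \<in> F \<Longrightarrow> u + unit_vector i \<in> region n C"
    by (rule irredundant_corner[OF valid(1) irr eq(2) c]) blast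
  have "u \<notin> region n C" using regionD(2)[OF _ c] u(2) by fastforce
  then obtain l where "(F, l) \<in> D" "weight F u < l"
    using corner_constraint[OF valid(2) u(1), of F] u(3,4) N eq(1) by (metis order_trans)
  with that u(2) show ?thesis by fastforce
qed

text \<open>
  By the previous lemma a constraint \<open>(F, k)\<close> of \<open>C\<close> is matched by some \<open>(F, l)\<close> of \<open>D\<close> with \<open>k \<le> l\<close>, and
  that one by some \<open>(F, m)\<close> of \<open>C\<close> with \<open>l \<le> m\<close>. If \<open>m\<close> were larger than \<open>k\<close>, then \<open>(F, k)\<close> would be
  redundant in \<open>C\<close>; so the three bounds coincide.
\<close>

lemma irredundant_constraints_subset:
  assumes valid: "C \<subseteq> Pow {1..n} \<times> {0<..}" "D \<subseteq> Pow {1..n} \<times> {0<..}"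
    and fin: "finite C" "finite D"
    and irr: "irredundant_constraints n C" "irredundant_constraints n D"
    and eq: "region n C = region n D" "region n C \<noteq> {}"
  shows "C \<subseteq> D"
proof safe
  fix F k assume c: "(F, k) \<in> C"
  obtain l where l: "(F, l) \<in> D" "k \<le> l"
    using irredundant_constraint_dominated[OF valid fin(2) irr(1) eq c] .
  obtain m where m: "(F, m) \<in> C" "l \<le> m"
    using irredundant_constraint_dominated[OF valid(2,1) fin(1) irr(2) eq(1)[symmetric] _ l(1)] eq
    by auto
  have "m = k"
  proof (rule ccontr)
    assume "m \<noteq> k"
    with m have m': "(F, m) \<in> C - {(F, k)}" by simp
    have "region n (C - {(F, k)}) \<subseteq> region n C"
    proof
      fix w assume w: "w \<in> region n (C - {(F, k)})"
      show "w \<in> region n C"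
      proof (rule regionI[OF regionD(1)[OF w]])
        fix G h assume "(G, h) \<in> C"
        then show "h \<le> weight G w"
          using regionD(2)[OF w m'] regionD(2)[OF w, of G h] l(2) m(2) by (cases "(G, h) = (F, k)") auto
      qed
    qed
    then have "region n (C - {(F, k)}) = region n C" by (simp add: region_antimono subset_antisym)
    with irr(1) c show False by (auto simp: irredundant_constraints_def)
  qed
  with l m show "(F, k) \<in> D" by simp
qed

lemma irredundant_constraints_unique:
  assumes "C \<subseteq> Pow {1..n} \<times> {0<..}" "D \<subseteq> Pow {1..n} \<times> {0<..}"
    and "finite C" "finite D"
    and "irredundant_constraints n C" "irredundant_constraints n D"
    and "region n C = region n D" "region n C \<noteq> {}"
  shows "C = D"
  using irredundant_constraints_subset[of C n D] irredundant_constraints_subset[of D n C] assms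
  by auto

section \<open>Monomial ideals\<close>

text \<open>
  The polynomials all of whose monomials have exponents in \<open>U\<close>. If \<open>U\<close> consists of
  exponent vectors and is closed under adding such vectors, this is the monomial ideal with monomials \<open>U\<close>.
\<close>

definition monomial_span :: "(nat \<Rightarrow>\<^sub>0 nat) set \<Rightarrow> ((nat \<Rightarrow>\<^sub>0 nat) \<Rightarrow>\<^sub>0 'k::field) set" where
  "monomial_span U = {f. Poly_Mapping.keys f \<subseteq> U}"

lemma mpoly_ring_simps [simp]:
  "carrier (mpoly_ring n) = monomial_span (exponents n)" "mult (mpoly_ring n) = (*)"
  "one (mpoly_ring n) = 1" "zero (mpoly_ring n) = 0" "add (mpoly_ring n) = (+)"
  by (auto simp: mpoly_ring_def monomial_span_def)

lemma monomial_spanD: "f \<in> monomial_span U \<Longrightarrow> u \<in> Poly_Mapping.keys f \<Longrightarrow> u \<in> U"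
  by (auto simp: monomial_span_def)

lemma monomial_span_mono: "U \<subseteq> V \<Longrightarrow> monomial_span U \<subseteq> monomial_span V"
  by (auto simp: monomial_span_def)

lemma keys_monomial: "Poly_Mapping.keys (monomial u :: _ \<Rightarrow>\<^sub>0 'k::field) = {u}"
  by (simp add: monomial_def)

lemma monomial_in_span_iff: "(monomial u :: _ \<Rightarrow>\<^sub>0 'k::field) \<in> monomial_span U \<longleftrightarrow> u \<in> U"
  by (simp add: monomial_span_def keys_monomial)

lemma monomial_span_eq_iff:
  "(monomial_span U :: (_ \<Rightarrow>\<^sub>0 'k::field) set) = monomial_span V \<longleftrightarrow> U = V"
proof
  assume eq: "(monomial_span U :: (_ \<Rightarrow>\<^sub>0 'k) set) = monomial_span V"
  show "U = V"
  proof (rule Set.set_eqI)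
    fix u
    show "u \<in> U \<longleftrightarrow> u \<in> V" using eq monomial_in_span_iff[where 'k='k] by metis
  qed
qed simp

lemma zero_in_monomial_span: "0 \<in> monomial_span U"
  by (simp add: monomial_span_def)

lemma monomial_span_add: "f \<in> monomial_span U \<Longrightarrow> g \<in> monomial_span U \<Longrightarrow> f + g \<in> monomial_span U"
  unfolding monomial_span_def using keys_add[of f g] by auto

lemma monomial_span_mult:
  assumes "f \<in> monomial_span U" "g \<in> monomial_span V" "\<And>u v. u \<in> U \<Longrightarrow> v \<in> V \<Longrightarrow> u + v \<in> W"
  shows "f * g \<in> monomial_span W"
  using assms keys_mult[of f g] unfolding monomial_span_def by blast

lemma sum_of_terms:
  fixes f :: "'a \<Rightarrow>\<^sub>0 'b::comm_monoid_add"
  shows "(\<Sum>u\<in>Poly_Mapping.keys f. Poly_Mapping.single u (lookup f u)) = f"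
proof (rule poly_mapping_eqI)
  fix v
  have "(\<Sum>u\<in>Poly_Mapping.keys f. lookup f u when u = v) = (lookup f v when v \<in> Poly_Mapping.keys f)"
    by (simp add: when_def)
  then show "lookup (\<Sum>u\<in>Poly_Mapping.keys f. Poly_Mapping.single u (lookup f u)) v = lookup f v"
    by (simp add: lookup_sum lookup_single when_def in_keys_iff)
qed

lemma monomial_mult: "monomial u * monomial v = (monomial (u + v) :: _ \<Rightarrow>\<^sub>0 'k::field)"
  by (simp add: monomial_def mult_single)

lemma lookup_monomial_mult:
  fixes f :: "(nat \<Rightarrow>\<^sub>0 nat) \<Rightarrow>\<^sub>0 'k::field"
  shows "lookup (monomial v * f) (v + u) = lookup f u"
proof -
  have "monomial v * f = monomial v * (\<Sum>w\<in>Poly_Mapping.keys f. Poly_Mapping.single w (lookup f w))"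
    by (simp only: sum_of_terms)
  also have "\<dots> = (\<Sum>w\<in>Poly_Mapping.keys f. Poly_Mapping.single (v + w) (lookup f w))"
    by (simp add: sum_distrib_left monomial_def mult_single)
  finally show ?thesis
    by (simp add: lookup_sum lookup_single when_def in_keys_iff)
qed

lemma monomial_mult_in_span_iff:
  fixes f :: "(nat \<Rightarrow>\<^sub>0 nat) \<Rightarrow>\<^sub>0 'k::field"
  shows "monomial v * f \<in> monomial_span U \<longleftrightarrow> (\<forall>u\<in>Poly_Mapping.keys f. v + u \<in> U)"
proof
  assume "monomial v * f \<in> monomial_span U"
  then show "\<forall>u\<in>Poly_Mapping.keys f. v + u \<in> U"
    using lookup_monomial_mult[of v f] by (auto simp: in_keys_iff dest!: monomial_spanD[of "monomial v * f"])
next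
  assume "\<forall>u\<in>Poly_Mapping.keys f. v + u \<in> U"
  then show "monomial v * f \<in> monomial_span U"
    by (intro monomial_span_mult[of _ "{v}" _ "Poly_Mapping.keys f"])
      (auto simp: monomial_span_def keys_monomial)
qed

lemma ideal_monomial_span:
  assumes "U \<subseteq> exponents n" "\<And>u v. u \<in> U \<Longrightarrow> v \<in> exponents n \<Longrightarrow> u + v \<in> U"
  shows "ideal (monomial_span U :: (_ \<Rightarrow>\<^sub>0 'k::field) set) (mpoly_ring n)"
proof -
  let ?R = "mpoly_ring n :: ((nat \<Rightarrow>\<^sub>0 nat) \<Rightarrow>\<^sub>0 'k) ring"
  interpret R: cring ?R by (rule cring_mpoly_ring)
  have sub: "monomial_span U \<subseteq> (carrier ?R)" using assms(1) monomial_span_mono by simp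
  have minus: "inv\<^bsub>add_monoid ?R\<^esub> f = - f" if "f \<in> monomial_span U" for f :: "_ \<Rightarrow>\<^sub>0 'k"
  proof -
    have "f \<in> carrier ?R" "- f \<in> carrier ?R" using that sub by (auto simp: monomial_span_def)
    then have "\<ominus>\<^bsub>?R\<^esub> f = - f" by (intro R.minus_equality) auto
    then show ?thesis by (simp add: a_inv_def)
  qed
  show ?thesis
  proof (rule idealI)
    show "ring ?R" by (rule R.ring_axioms)
    show "subgroup (monomial_span U) (add_monoid ?R)"
    proof (rule subgroup.intro)
      show "inv\<^bsub>add_monoid ?R\<^esub> f \<in> monomial_span U" if "f \<in> monomial_span U" for f
        using that minus[OF that] by (simp add: monomial_span_def)
    qed (use sub in \<open>simp_all add: monomial_span_add zero_in_monomial_span\<close>)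
    fix f g :: "_ \<Rightarrow>\<^sub>0 'k" assume f: "f \<in> monomial_span U" and g: "g \<in> carrier ?R"
    then have "f * g \<in> monomial_span U"
      using monomial_span_mult[of f U g "exponents n" U] assms(2) by simp
    then show "g \<otimes>\<^bsub>?R\<^esub> f \<in> monomial_span U" "f \<otimes>\<^bsub>?R\<^esub> g \<in> monomial_span U"
      by (simp_all add: mult.commute)
  qed
qed

lemma ideal_region: "ideal (monomial_span (region n C) :: (_ \<Rightarrow>\<^sub>0 'k::field) set) (mpoly_ring n)"
  by (rule ideal_monomial_span) (blast intro: region_add regionD(1))+

lemma monomial_span_subset_ideal:
  fixes J :: "((nat \<Rightarrow>\<^sub>0 nat) \<Rightarrow>\<^sub>0 'k::field) set"
  assumes J: "ideal J (mpoly_ring n)" and U: "U \<subseteq> exponents n" "\<And>u. u \<in> U \<Longrightarrow> monomial u \<in> J"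
  shows "monomial_span U \<subseteq> J"
proof
  fix f :: "(nat \<Rightarrow>\<^sub>0 nat) \<Rightarrow>\<^sub>0 'k" assume f: "f \<in> monomial_span U"
  have term_in: "Poly_Mapping.single u c \<in> J" if "u \<in> U" for u c
  proof -
    have "Poly_Mapping.single 0 c \<in> carrier (mpoly_ring n :: ((nat \<Rightarrow>\<^sub>0 nat) \<Rightarrow>\<^sub>0 'k) ring)"
      by (auto simp: monomial_span_def exponents_def)
    then have "Poly_Mapping.single 0 c \<otimes>\<^bsub>mpoly_ring n\<^esub> monomial u \<in> J"
      using ideal.I_l_closed[OF J U(2)[OF that]] by blast
    then show ?thesis by (simp add: monomial_def mult_single)
  qed
  have zero: "0 \<in> J"
    using additive_subgroup.zero_closed[OF ideal.axioms(1)[OF J]] by simp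
  have add: "a + b \<in> J" if "a \<in> J" "b \<in> J" for a b
    using additive_subgroup.a_closed[OF ideal.axioms(1)[OF J] that] by simp
  have "(\<Sum>u\<in>A. Poly_Mapping.single u (lookup f u)) \<in> J" if "finite A" "A \<subseteq> U" for A
    using that by (induction A rule: finite_induct) (auto simp: zero add term_in)
  from this[of "Poly_Mapping.keys f"] show "f \<in> J"
    using f by (simp add: sum_of_terms monomial_span_def)
qed

lemma genideal_monomials:
  assumes U: "U \<subseteq> exponents n"
  shows "Idl\<^bsub>mpoly_ring n\<^esub> (monomial ` U :: (_ \<Rightarrow>\<^sub>0 'k::field) set)
    = monomial_span {w \<in> exponents n. \<exists>u\<in>U. lookup u \<le> lookup w}" (is "?I = monomial_span ?W")
proof
  let ?R = "mpoly_ring n :: ((nat \<Rightarrow>\<^sub>0 nat) \<Rightarrow>\<^sub>0 'k) ring"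
  interpret R: cring ?R by (rule cring_mpoly_ring)
  have carr: "monomial ` U \<subseteq> carrier ?R" using U by (auto simp: monomial_in_span_iff)
  show "?I \<subseteq> monomial_span ?W"
  proof (rule R.genideal_minimal)
    show "ideal (monomial_span ?W) ?R"
      by (rule ideal_monomial_span)
        (auto simp: exponents_add lookup_add le_fun_def intro: trans_le_add1)
    show "monomial ` U \<subseteq> monomial_span ?W" using U by (auto simp: monomial_in_span_iff)
  qed
  have ideal: "ideal ?I ?R" by (rule R.genideal_ideal[OF carr])
  show "monomial_span ?W \<subseteq> ?I"
  proof (rule monomial_span_subset_ideal[OF ideal])
    fix w assume "w \<in> ?W"
    then obtain u where w: "w \<in> exponents n" and u: "u \<in> U" "lookup u \<le> lookup w" by blast
    have "w - u \<in> exponents n"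
      by (rule exponents_downward[OF w]) (simp add: le_fun_def lookup_minus)
    then have "monomial (w - u) \<in> carrier ?R" by (simp add: monomial_in_span_iff)
    moreover have "monomial u \<in> ?I" using R.genideal_self[OF carr] u(1) by blast
    ultimately have "monomial (w - u) \<otimes>\<^bsub>?R\<^esub> monomial u \<in> ?I"
      by (intro ideal.I_l_closed[OF ideal])
    moreover have "(w - u) + u = w"
      by (rule poly_mapping_eqI) (use u(2) in \<open>simp add: lookup_add lookup_minus le_fun_def\<close>)
    ultimately show "monomial w \<in> ?I" by (simp add: monomial_mult)
  qed blast
qed

lemma monomial_prime_eq:
  assumes F: "F \<subseteq> {1..n}"
  shows "(monomial_prime n F :: (_ \<Rightarrow>\<^sub>0 'k::field) set) = monomial_span (region n {(F, 1)})"
proof -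
  have finF: "finite F" using F finite_subset by blast
  have "unit_vector ` F \<subseteq> exponents n" using F unit_vector_exponents by blast
  then have "(monomial_prime n F :: (_ \<Rightarrow>\<^sub>0 'k) set)
      = monomial_span {w \<in> exponents n. \<exists>u\<in>unit_vector ` F. lookup u \<le> lookup w}"
    unfolding monomial_prime_def variable_def using genideal_monomials[of "unit_vector ` F" n]
    by (simp add: image_image)
  also have "{w \<in> exponents n. \<exists>u\<in>unit_vector ` F. lookup u \<le> lookup w} = region n {(F, 1)}"
  proof -
    have unit_le: "lookup (unit_vector i) \<le> lookup w \<longleftrightarrow> lookup w i \<noteq> 0" for i and w :: "nat \<Rightarrow>\<^sub>0 nat"
      by (auto simp: le_fun_def lookup_single when_def)
    have "1 \<le> weight F w \<longleftrightarrow> (\<exists>i\<in>F. lookup w i \<noteq> 0)" for w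
      using weight_eq_0_iff[OF finF, of w] by (cases "weight F w") auto
    then show ?thesis by (simp add: region_def unit_le del: One_nat_def)
  qed
  finally show ?thesis .
qed

text \<open>
  The monomials of a product of \<open>k\<close> elements of the prime of \<open>F\<close> have degree at least \<open>k\<close> in the variables from \<open>F\<close>; conversely
  a monomial of positive degree in these variables can be divided by one of them.
\<close>

lemma ideal_power_monomial_prime:
  assumes F: "F \<subseteq> {1..n}"
  shows "(ideal_power (mpoly_ring n) (monomial_prime n F) k :: (_ \<Rightarrow>\<^sub>0 'k::field) set)
    = monomial_span (region n {(F, k)})"
proof (induction k)
  case 0
  then show ?case by (simp add: ideal_power_def ideals_set_def region_def)
next
  case (Suc k)
  let ?R = "mpoly_ring n :: ((nat \<Rightarrow>\<^sub>0 nat) \<Rightarrow>\<^sub>0 'k) ring"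
  let ?A = "monomial_span (region n {(F, k)}) :: (_ \<Rightarrow>\<^sub>0 'k) set"
  let ?B = "monomial_span (region n {(F, 1)}) :: (_ \<Rightarrow>\<^sub>0 'k) set"
  interpret R: cring ?R by (rule cring_mpoly_ring)
  have finF: "finite F" using F finite_subset by blast
  have "ideal_power ?R (monomial_prime n F) (Suc k)
      = ideal_prod ?R (ideal_power ?R (monomial_prime n F) k) (monomial_prime n F)"
    by (simp add: ideal_power_def ideals_set_def)
  also have "\<dots> = ideal_prod ?R ?A ?B"
    unfolding Suc.IH unfolding monomial_prime_eq[OF F] by (rule refl)
  also have "\<dots> = monomial_span (region n {(F, Suc k)})"
  proof
    have ideal: "ideal (ideal_prod ?R ?A ?B) ?R"
      by (intro R.ideal_prod_is_ideal ideal_region)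
    show "ideal_prod ?R ?A ?B \<subseteq> monomial_span (region n {(F, Suc k)})"
    proof
      fix f assume "f \<in> ideal_prod ?R ?A ?B"
      then show "f \<in> monomial_span (region n {(F, Suc k)})"
      proof (induction rule: ideal_prod.induct)
        case (prod a b)
        then have "a * b \<in> monomial_span (region n {(F, Suc k)})"
          by (rule monomial_span_mult) (auto simp: region_def exponents_add weight_add)
        then show ?case by simp
      qed (simp add: monomial_span_add)
    qed
    show "monomial_span (region n {(F, Suc k)}) \<subseteq> ideal_prod ?R ?A ?B"
    proof (rule monomial_span_subset_ideal[OF ideal])
      fix w assume "w \<in> region n {(F, Suc k)}"
      then have w: "w \<in> exponents n" "Suc k \<le> weight F w" by (auto simp: region_def)
      then have "weight F w \<noteq> 0" by simp
      then obtain i where i: "i \<in> F" "lookup w i \<noteq> 0" using weight_eq_0_iff[OF finF, of w] by auto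
      obtain v where v: "v \<in> exponents n" "w = v + unit_vector i"
        using exponents_minus_unit_vector[OF w(1) i(2)] .
      have "weight F w = weight F v + 1"
        using i(1) finF by (simp add: v(2) weight_add weight_single)
      then have "v \<in> region n {(F, k)}" using v(1) w(2) by (simp add: region_def)
      moreover have "unit_vector i \<in> region n {(F, 1)}"
        using i(1) F finF unit_vector_exponents[of i n] by (auto simp: region_def weight_single)
      ultimately have "monomial v \<otimes>\<^bsub>?R\<^esub> monomial (unit_vector i) \<in> ideal_prod ?R ?A ?B"
        by (intro ideal_prod.prod) (simp_all only: monomial_in_span_iff)
      then show "monomial w \<in> ideal_prod ?R ?A ?B"
        by (simp only: mpoly_ring_simps monomial_mult v(2))
    qed (auto simp: region_def)
  qed
  finally show ?case .
qed

section \<open>Associated primes\<close>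

lemma Ass_quot_module_iff:
  fixes R (structure)
  assumes R: "cring R" and I: "ideal I R"
  shows "Q \<in> Ass R (quot_module R I)
    \<longleftrightarrow> primeideal Q R \<and> (\<exists>g\<in>carrier R. Q = {a \<in> carrier R. a \<otimes> g \<in> I})"
proof -
  interpret cring R by fact
  interpret ideal I R by fact
  have ann: "annihilator R (quot_module R I) (I +> g) = {a \<in> carrier R. a \<otimes> g \<in> I}"
    if g: "g \<in> carrier R" for g
  proof -
    have "(I +> a) \<otimes>\<^bsub>R Quot I\<^esub> (I +> g) = \<zero>\<^bsub>R Quot I\<^esub> \<longleftrightarrow> a \<otimes> g \<in> I" if a: "a \<in> carrier R" for a
    proof -
      have "(I +> a) \<otimes>\<^bsub>R Quot I\<^esub> (I +> g) = I +> (a \<otimes> g)"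
        using rcoset_mult_add[OF a g] by (simp add: FactRing_def)
      moreover have "I +> (a \<otimes> g) = I \<longleftrightarrow> a \<otimes> g \<in> I"
        using m_closed[OF a g] rcos_const_imp_mem a_rcos_zero[OF I] by blast
      ultimately show ?thesis by (simp add: FactRing_def)
    qed
    then show ?thesis by (simp add: annihilator_def quot_module_def cong: conj_cong)
  qed
  have "carrier (quot_module R I) = (\<lambda>g. I +> g) ` carrier R"
    by (auto simp: quot_module_def FactRing_def A_RCOSETS_def')
  with ann show ?thesis by (auto simp: Ass_def)
qed

lemma monomial_span_sum:
  "(\<And>x. x \<in> A \<Longrightarrow> g x \<in> monomial_span U) \<Longrightarrow> sum g A \<in> monomial_span U"
  by (induction A rule: infinite_finite_induct) (auto simp: monomial_span_add zero_in_monomial_span)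

lemma monomial_span_split:
  assumes "f \<in> monomial_span U"
  obtains g h where "f = g + h" "g \<in> monomial_span (U \<inter> V)" "h \<in> monomial_span (U - V)"
proof
  let ?s = "\<lambda>A. \<Sum>u\<in>A. Poly_Mapping.single u (lookup f u)"
  show "f = ?s (Poly_Mapping.keys f \<inter> V) + ?s (Poly_Mapping.keys f - V)"
    by (simp add: sum_of_terms flip: sum.Int_Diff)
  show "?s (Poly_Mapping.keys f \<inter> V) \<in> monomial_span (U \<inter> V)"
    "?s (Poly_Mapping.keys f - V) \<in> monomial_span (U - V)"
    using assms by (intro monomial_span_sum; auto simp: monomial_span_def)+
qed

text \<open>
  Modulo the prime of \<open>F\<close>, a polynomial is represented by its part \<open>a\<^sub>0\<close> that is free of the variables from \<open>F\<close>.
  A product \<open>a\<^sub>0 * b\<^sub>0\<close> of such parts is again free of these variables, so if it lies in the prime, it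
  vanishes, and polynomials have no zero divisors.
\<close>

lemma primeideal_monomial_prime:
  assumes F: "F \<subseteq> {1..n}"
  shows "primeideal (monomial_prime n F :: (_ \<Rightarrow>\<^sub>0 'k::field) set) (mpoly_ring n)"
proof -
  let ?R = "mpoly_ring n :: ((nat \<Rightarrow>\<^sub>0 nat) \<Rightarrow>\<^sub>0 'k) ring"
  let ?J = "monomial_span (region n {(F, 1)}) :: ((nat \<Rightarrow>\<^sub>0 nat) \<Rightarrow>\<^sub>0 'k) set"
  let ?N = "{u \<in> exponents n. weight F u = 0}"
  have split: "\<exists>g h. f = g + h \<and> g \<in> monomial_span ?N \<and> h \<in> ?J"
    if f: "f \<in> carrier ?R" for f
  proof -
    have f': "f \<in> monomial_span (exponents n)" using f by simp
    obtain g h where "f = g + h" "g \<in> monomial_span (exponents n \<inter> {u. weight F u = 0})"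
      "h \<in> monomial_span (exponents n - {u. weight F u = 0})"
      by (rule monomial_span_split[OF f'])
    moreover have "exponents n \<inter> {u. weight F u = 0} = ?N" by blast
    moreover have "exponents n - {u. weight F u = 0} = region n {(F, 1)}"
      by (auto simp: region_def Suc_le_eq)
    ultimately show ?thesis by metis
  qed
  have "primeideal ?J ?R"
  proof (rule primeidealI)
    show "ideal ?J ?R" by (rule ideal_region)
    show "cring ?R" by (rule cring_mpoly_ring)
    have "monomial 0 \<in> carrier ?R" "monomial 0 \<notin> ?J"
      by (auto simp: monomial_in_span_iff exponents_iff region_def weight_def)
    then show "carrier ?R \<noteq> ?J" by metis
    fix a b assume a: "a \<in> carrier ?R" and b: "b \<in> carrier ?R" and ab: "a \<otimes>\<^bsub>?R\<^esub> b \<in> ?J"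
    obtain a0 a1 where a01: "a = a0 + a1" "a0 \<in> monomial_span ?N" "a1 \<in> ?J" using split[OF a] by blast
    obtain b0 b1 where b01: "b = b0 + b1" "b0 \<in> monomial_span ?N" "b1 \<in> ?J" using split[OF b] by blast
    have J_mult: "f * g \<in> ?J" if "f \<in> ?J" "g \<in> monomial_span (exponents n)" for f g
      using that by (rule monomial_span_mult) (auto simp: region_add region_def weight_add exponents_add)
    have "a0 \<in> monomial_span (exponents n)" using a01(2) by (auto simp: monomial_span_def)
    then have "a1 * b \<in> ?J" "b1 * a0 \<in> ?J" using a01 b01 b J_mult by simp_all
    then have "a1 * b + b1 * a0 \<in> ?J" by (rule monomial_span_add)
    then have "a * b + - (a1 * b + b1 * a0) \<in> ?J"
      using ab by (intro monomial_span_add) (simp_all add: monomial_span_def del: minus_add_distrib)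
    moreover have "a * b + - (a1 * b + b1 * a0) = a0 * b0"
      using a01(1) b01(1) by (simp add: algebra_simps)
    ultimately have "a0 * b0 \<in> ?J" by simp
    moreover have "a0 * b0 \<in> monomial_span ?N"
      using a01(2) b01(2) by (rule monomial_span_mult) (simp add: exponents_add weight_add)
    ultimately have "Poly_Mapping.keys (a0 * b0) \<subseteq> region n {(F, 1)} \<inter> ?N"
      by (auto simp: monomial_span_def)
    also have "region n {(F, 1)} \<inter> ?N = {}" by (auto simp: region_def)
    finally have "a0 * b0 = 0" by simp
    then have "a0 = 0 \<or> b0 = 0" by simp
    then show "a \<in> ?J \<or> b \<in> ?J" using a01 b01 by auto
  qed
  then show ?thesis by (simp only: monomial_prime_eq[OF F])
qed

text \<open>
  If \<open>F\<close> occurs in the system, the monomial at a corner has the prime of \<open>F\<close> as annihilator. Conversely, let that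
  prime be the annihilator of a polynomial \<open>g\<close>. A high power \<open>x\<^sup>m\<close> of the product of the variables outside
  \<open>F\<close> is not in the prime, so some monomial \<open>x\<^sup>v\<close> of \<open>g\<close> satisfies \<open>x\<^sup>m x\<^sup>v \<notin> I\<close>, while \<open>x\<^sub>i x\<^sup>v \<in> I\<close> for
  \<open>i \<in> F\<close>. So \<open>m + v\<close> is a corner in direction \<open>F\<close>, and \<open>F\<close> occurs in the system.
\<close>

lemma Ass_region_iff:
  fixes C :: "(nat set \<times> nat) set" and n :: nat
  defines "I \<equiv> monomial_span (region n C) :: ((nat \<Rightarrow>\<^sub>0 nat) \<Rightarrow>\<^sub>0 'k::field) set"
  assumes valid: "C \<subseteq> Pow {1..n} \<times> {0<..}" and fin: "finite C"
    and irr: "irredundant_constraints n C" and nonempty: "region n C \<noteq> {}" and F: "F \<subseteq> {1..n}"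
  shows "monomial_prime n F \<in> Ass (mpoly_ring n) (quot_module (mpoly_ring n) I) \<longleftrightarrow> F \<in> fst ` C"
proof -
  let ?R = "mpoly_ring n :: ((nat \<Rightarrow>\<^sub>0 nat) \<Rightarrow>\<^sub>0 'k) ring"
  let ?p = "monomial_span (region n {(F, 1)}) :: ((nat \<Rightarrow>\<^sub>0 nat) \<Rightarrow>\<^sub>0 'k) set"
  have finF: "finite F" using F finite_subset by blast
  have Ass: "monomial_prime n F \<in> Ass ?R (quot_module ?R I)
    \<longleftrightarrow> (\<exists>g\<in>carrier ?R. ?p = {a \<in> carrier ?R. a * g \<in> I})"
  proof -
    have "ideal I ?R" unfolding I_def by (rule ideal_region)
    then show ?thesis
      unfolding monomial_prime_eq[OF F] Ass_quot_module_iff[OF cring_mpoly_ring \<open>ideal I ?R\<close>]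
      using primeideal_monomial_prime[OF F, where 'k='k]
      by (simp only: monomial_prime_eq[OF F] mpoly_ring_simps simp_thms)
  qed
  show ?thesis unfolding Ass
  proof
    assume "\<exists>g\<in>carrier ?R. ?p = {a \<in> carrier ?R. a * g \<in> I}"
    then obtain g where g: "g \<in> carrier ?R" and p: "?p = {a \<in> carrier ?R. a * g \<in> I}" by blast
    have p_iff: "u \<in> region n {(F, 1)} \<longleftrightarrow> (\<forall>v\<in>Poly_Mapping.keys g. u + v \<in> region n C)"
      if "u \<in> exponents n" for u
    proof -
      have "u \<in> region n {(F, 1)} \<longleftrightarrow> (monomial u :: _ \<Rightarrow>\<^sub>0 'k) \<in> ?p"
        by (simp only: monomial_in_span_iff)
      also have "\<dots> \<longleftrightarrow> monomial u * g \<in> I"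
        unfolding p using that by (simp add: monomial_in_span_iff)
      finally show ?thesis by (simp only: I_def monomial_mult_in_span_iff)
    qed
    obtain N where N: "\<And>G l. (G, l) \<in> C \<Longrightarrow> l \<le> N"
      using constraint_bound[OF fin] by blast
    have "\<exists>m\<in>exponents n. lookup m = (\<lambda>i. if i \<in> {1..n} - F then N else 0)"
      by (rule exponents_of_function) auto
    then obtain m where m: "m \<in> exponents n" "lookup m = (\<lambda>i. if i \<in> {1..n} - F then N else 0)"
      by blast
    have "m \<notin> region n {(F, 1)}" using finF by (auto simp: region_def weight_def m(2))
    then obtain v where v: "v \<in> Poly_Mapping.keys g" "m + v \<notin> region n C"
      using p_iff[OF m(1)] by blast
    have v_exp: "v \<in> exponents n" using g v(1) by (auto simp: monomial_span_def)
    obtain l where "(F, l) \<in> C" "weight F (m + v) < l"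
    proof (rule corner_constraint[OF valid _ v(2), of F])
      show "m + v \<in> exponents n" using m(1) v_exp by (rule exponents_add)
      show "m + v + unit_vector i \<in> region n C" if i: "i \<in> F" for i
      proof -
        have unit: "unit_vector i \<in> exponents n" using i F by (intro unit_vector_exponents) blast
        moreover have "unit_vector i \<in> region n {(F, 1)}"
          using unit i finF by (simp add: region_def weight_single)
        ultimately have "unit_vector i + v \<in> region n C" using p_iff v(1) by blast
        then have "unit_vector i + v + m \<in> region n C" using m(1) by (rule region_add)
        then show ?thesis by (simp only: ac_simps)
      qed
      show "l \<le> lookup (m + v) j" if "j \<in> {1..n} - F" "(G, l) \<in> C" for j G l
        using that N[OF that(2)] by (simp add: lookup_add m(2))
    qed
    then show "F \<in> fst ` C" by force
  next
    assume "F \<in> fst ` C"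
    then obtain k where k: "(F, k) \<in> C" by force
    obtain u where u: "u \<in> exponents n" "weight F u + 1 = k"
      and shift: "\<And>i. i \<in> F \<Longrightarrow> u + unit_vector i \<in> region n C"
      by (rule irredundant_corner[OF valid irr nonempty k, of 0]) blast
    have iff: "v + u \<in> region n C \<longleftrightarrow> v \<in> region n {(F, 1)}" if v: "v \<in> exponents n" for v
    proof
      assume "v + u \<in> region n C"
      then have "k \<le> weight F v + weight F u" using regionD(2)[OF _ k] by (simp flip: weight_add)
      with u(2) v show "v \<in> region n {(F, 1)}" by (simp add: region_def)
    next
      assume "v \<in> region n {(F, 1)}"
      then have "weight F v \<noteq> 0" by (auto simp: region_def)
      then obtain i where i: "i \<in> F" "lookup v i \<noteq> 0" using weight_eq_0_iff[OF finF, of v] by auto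
      obtain v' where v': "v' \<in> exponents n" "v = v' + unit_vector i"
        using exponents_minus_unit_vector[OF v i(2)] .
      have "u + unit_vector i + v' \<in> region n C"
        by (rule region_add[OF shift[OF i(1)] v'(1)])
      then show "v + u \<in> region n C" by (simp only: v'(2) ac_simps)
    qed
    have "?p = {a \<in> carrier ?R. a * monomial u \<in> I}"
    proof (rule Set.set_eqI)
      fix a :: "(nat \<Rightarrow>\<^sub>0 nat) \<Rightarrow>\<^sub>0 'k"
      have "a * monomial u \<in> I \<longleftrightarrow> (\<forall>v\<in>Poly_Mapping.keys a. v + u \<in> region n C)"
        using monomial_mult_in_span_iff[of u a "region n C"] by (simp add: I_def ac_simps)
      then show "a \<in> ?p \<longleftrightarrow> a \<in> {a \<in> carrier ?R. a * monomial u \<in> I}"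
        using iff by (auto simp: monomial_span_def subset_iff dest: regionD(1))
    qed
    moreover have "monomial u \<in> carrier ?R" using u(1) by (simp add: monomial_in_span_iff)
    ultimately show "\<exists>g\<in>carrier ?R. ?p = {a \<in> carrier ?R. a * g \<in> I}" by blast
  qed
qed

section \<open>Presentations as intersections of powers of monomial primes\<close>

definition component :: "nat \<Rightarrow> nat set \<times> nat \<Rightarrow> ((nat \<Rightarrow>\<^sub>0 nat) \<Rightarrow>\<^sub>0 'k::field) set" where
  "component n c = ideal_power (mpoly_ring n) (monomial_prime n (fst c)) (snd c)"

lemma region_eq_Inter_components:
  assumes "C \<subseteq> Pow {1..n} \<times> {0<..}"
  shows "carrier (mpoly_ring n) \<inter> \<Inter> (component n ` C)
    = (monomial_span (region n C) :: (_ \<Rightarrow>\<^sub>0 'k::field) set)"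
proof -
  have comp: "component n c = (monomial_span (region n {c}) :: (_ \<Rightarrow>\<^sub>0 'k) set)" if "c \<in> C" for c
    using assms that ideal_power_monomial_prime[of "fst c" n "snd c", where 'k='k]
    by (auto simp: component_def)
  have "carrier (mpoly_ring n) \<inter> \<Inter> (component n ` C)
      = (monomial_span (exponents n) \<inter> (\<Inter>c\<in>C. monomial_span (region n {c})) :: (_ \<Rightarrow>\<^sub>0 'k) set)"
    using comp by simp
  also have "\<dots> = monomial_span (region n C)"
    by (auto simp: monomial_span_def region_def)
  finally show ?thesis .
qed

lemma irredundant_presentation_of_constraints:
  assumes valid: "C \<subseteq> Pow {1..n} \<times> {0<..}" and fin: "finite C"
    and irr: "irredundant_constraints n C"
  shows "irredundant_presentation n (monomial_span (region n C) :: (_ \<Rightarrow>\<^sub>0 'k::field) set)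
    (component n ` C)"
proof -
  let ?S = "carrier (mpoly_ring n) :: ((nat \<Rightarrow>\<^sub>0 nat) \<Rightarrow>\<^sub>0 'k) set"
  let ?D = "component n ` C :: ((nat \<Rightarrow>\<^sub>0 nat) \<Rightarrow>\<^sub>0 'k) set set"
  have "monomial_span (region n C) \<noteq> ?S \<inter> \<Inter> (?D - {component n c})" if c: "c \<in> C" for c
  proof
    assume eq: "monomial_span (region n C) = ?S \<inter> \<Inter> (?D - {component n c})"
    have "monomial_span (region n (C - {c})) = ?S \<inter> \<Inter> (component n ` (C - {c}))"
      by (rule region_eq_Inter_components[symmetric]) (use valid in blast)
    also have "\<dots> \<subseteq> ?S \<inter> \<Inter> (?D - {component n c})" by blast
    also have "\<dots> = monomial_span (region n C)" by (rule eq[symmetric])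
    finally have "(monomial_span (region n (C - {c})) :: (_ \<Rightarrow>\<^sub>0 'k) set) = monomial_span (region n C)"
      by (simp add: subset_antisym monomial_span_mono region_antimono)
    with irr c show False by (auto simp: monomial_span_eq_iff irredundant_constraints_def)
  qed
  moreover have "\<exists>F k. F \<subseteq> {1..n} \<and> 0 < k \<and> (component n c :: (_ \<Rightarrow>\<^sub>0 'k) set)
      = ideal_power (mpoly_ring n) (monomial_prime n F) k" if "c \<in> C" for c
  proof -
    have "c \<in> Pow {1..n} \<times> {0<..}" using valid that by blast
    then show ?thesis
      by (intro exI[of _ "fst c"] exI[of _ "snd c"]) (simp add: component_def mem_Times_iff)
  qed
  ultimately show ?thesis
    unfolding irredundant_presentation_def
    using fin region_eq_Inter_components[OF valid, where 'k='k] by auto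
qed

text \<open>
  Choosing one pair for each component keeps the indexing injective, so that dropping a constraint
  drops exactly one component, and irredundancy carries over. (The zero ideal, for \<open>F = {}\<close>, is the same
  component for all exponents, so a choice is really made.)
\<close>

lemma constraints_of_irredundant_presentation:
  fixes I :: "((nat \<Rightarrow>\<^sub>0 nat) \<Rightarrow>\<^sub>0 'k::field) set"
  assumes "irredundant_presentation n I \<D>"
  obtains C where "C \<subseteq> Pow {1..n} \<times> {0<..}" "finite C" "irredundant_constraints n C"
    "I = monomial_span (region n C)" "\<D> = component n ` C"
proof -
  have fin: "finite \<D>"
    and powers: "\<And>Q. Q \<in> \<D> \<Longrightarrow> \<exists>F k. F \<subseteq> {1..n} \<and> 0 < k
      \<and> Q = ideal_power (mpoly_ring n) (monomial_prime n F) k"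
    and I: "I = carrier (mpoly_ring n) \<inter> \<Inter>\<D>"
    and irr: "\<And>Q. Q \<in> \<D> \<Longrightarrow> I \<noteq> carrier (mpoly_ring n) \<inter> \<Inter>(\<D> - {Q})"
    using assms unfolding irredundant_presentation_def by blast+
  have "\<D> \<subseteq> component n ` (Pow {1..n} \<times> {0<..})"
  proof
    fix Q assume "Q \<in> \<D>"
    then obtain F k where "F \<subseteq> {1..n}" "0 < k"
      "Q = ideal_power (mpoly_ring n) (monomial_prime n F) k"
      using powers by blast
    then show "Q \<in> component n ` (Pow {1..n} \<times> {0<..})"
      by (intro image_eqI[of _ _ "(F, k)"]) (auto simp: component_def)
  qed
  then obtain C where C: "C \<subseteq> Pow {1..n} \<times> {0<..}"
    and inj: "inj_on (component n :: _ \<Rightarrow> (_ \<Rightarrow>\<^sub>0 'k) set) C" and D: "\<D> = component n ` C"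
    unfolding subset_image_inj by blast
  have I': "I = monomial_span (region n C)"
    using I D region_eq_Inter_components[OF C, where 'k='k] by simp
  have "region n (C - {c}) \<noteq> region n C" if c: "c \<in> C" for c
  proof
    assume eq: "region n (C - {c}) = region n C"
    have C': "C - {c} \<subseteq> Pow {1..n} \<times> {0<..}" using C by blast
    have "\<D> - {component n c} = component n ` (C - {c})"
      using inj_on_image_set_diff[OF inj, of C "{c}"] c D by simp
    then have "carrier (mpoly_ring n) \<inter> \<Inter>(\<D> - {component n c}) = I"
      using region_eq_Inter_components[OF C', where 'k='k] eq I' by simp
    with irr[of "component n c"] c D show False by blast
  qed
  moreover have "finite C" using fin D inj finite_imageD by blast
  ultimately show ?thesis using that C I' D by (simp add: irredundant_constraints_def)
qed

lemma polymatroidal_ideal_eq_region: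
  assumes P: "discrete_polymatroid n P"
  defines "k \<equiv> \<lambda>F. polymatroid_rank n P - rank_fun n P ({1..n} - F)"
  shows "(polymatroidal_ideal n P :: (_ \<Rightarrow>\<^sub>0 'k::field) set)
    = monomial_span (region n ((\<lambda>F. (F, k F)) ` {F. F \<subseteq> {1..n} \<and> 0 < k F}))"
proof -
  have "bases n P \<subseteq> exponents n" using polymatroid_exponents[OF P] by (auto simp: bases_def)
  then have "(polymatroidal_ideal n P :: (_ \<Rightarrow>\<^sub>0 'k) set)
      = monomial_span {w \<in> exponents n. \<exists>u\<in>bases n P. lookup u \<le> lookup w}"
    unfolding polymatroidal_ideal_def by (rule genideal_monomials)
  also have "{w \<in> exponents n. \<exists>u\<in>bases n P. lookup u \<le> lookup w}
      = region n ((\<lambda>F. (F, k F)) ` {F. F \<subseteq> {1..n} \<and> 0 < k F})"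
  proof (rule Set.set_eqI)
    fix w
    have "(\<forall>F\<subseteq>{1..n}. k F \<le> weight F w) \<longleftrightarrow> (\<forall>F\<in>{F. F \<subseteq> {1..n} \<and> 0 < k F}. k F \<le> weight F w)"
      by (metis (no_types, lifting) gr0I le0 mem_Collect_eq)
    then show "w \<in> {w \<in> exponents n. \<exists>u\<in>bases n P. lookup u \<le> lookup w} \<longleftrightarrow>
        w \<in> region n ((\<lambda>F. (F, k F)) ` {F. F \<subseteq> {1..n} \<and> 0 < k F})"
      using dominates_base_iff[OF P, of w] by (auto simp: region_def k_def)
  qed
  finally show ?thesis .
qed

text \<open>
  The constraints \<open>w(F) \<ge> d - \<rho>([n] - F)\<close> for all \<open>F\<close> may be redundant. An irredundant subsystem \<open>C\<close> describes
  the same ideal, its sets are those of the associated primes, and each set carries the bound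
  prescribed by the rank function, because \<open>C\<close> is a subsystem.
\<close>

theorem theorem2p4:
  fixes n d :: nat
    and P :: "(nat \<Rightarrow>\<^sub>0 nat) set"
    and S :: "((nat \<Rightarrow>\<^sub>0 nat) \<Rightarrow>\<^sub>0 'k::field) ring"
    and I :: "((nat \<Rightarrow>\<^sub>0 nat) \<Rightarrow>\<^sub>0 'k) set"
  assumes "S = mpoly_ring n"
    and "discrete_polymatroid n P"
    and "d = polymatroid_rank n P"
    and "I = polymatroidal_ideal n P"
  shows "I = carrier S \<inter>
             (\<Inter>F\<in>{F. F \<subseteq> {1..n} \<and> monomial_prime n F \<in> Ass S (quot_module S I)}.
                ideal_power S (monomial_prime n F) (d - rank_fun n P ({1..n} - F)))
         \<and> (\<forall>F. F \<subseteq> {1..n} \<and> monomial_prime n F \<in> Ass S (quot_module S I) \<longrightarrow>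
                0 < d - rank_fun n P ({1..n} - F))
         \<and> canonical_primary_decomposition n I
             ((\<lambda>F. ideal_power S (monomial_prime n F) (d - rank_fun n P ({1..n} - F))) `
                {F. F \<subseteq> {1..n} \<and> monomial_prime n F \<in> Ass S (quot_module S I)})"
proof -
  define k where "k F = d - rank_fun n P ({1..n} - F)" for F
  define A where "A = (\<lambda>F. (F, k F)) ` {F. F \<subseteq> {1..n} \<and> 0 < k F}"
  have I_A: "I = monomial_span (region n A)"
    using polymatroidal_ideal_eq_region[OF assms(2), where 'k='k]
    unfolding A_def k_def assms(3,4) .
  have A: "A \<subseteq> Pow {1..n} \<times> {0<..}" "finite A"
    by (auto simp: A_def)
  obtain C where CA: "C \<subseteq> A" and C_A: "region n C = region n A"
    and irr: "irredundant_constraints n C"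
    using ex_irredundant_subset[OF A(2)] by metis
  have valid: "C \<subseteq> Pow {1..n} \<times> {0<..}" and fin: "finite C"
    using CA A finite_subset by blast+
  have I: "I = monomial_span (region n C)" using I_A C_A by simp
  have nonempty: "region n C \<noteq> {}"
  proof -
    obtain b where "b \<in> bases n P" using bases_nonempty[OF assms(2)] by blast
    then have "b \<in> exponents n" "\<exists>b'\<in>bases n P. lookup b' \<le> lookup b"
      using polymatroid_exponents[OF assms(2)] by (auto simp: bases_def)
    then have "b \<in> region n A"
      using dominates_base_iff[OF assms(2), of b] by (auto simp: region_def A_def k_def assms(3))
    with C_A show ?thesis by blast
  qed
  define \<F> where "\<F> = {F. F \<subseteq> {1..n} \<and> monomial_prime n F \<in> Ass S (quot_module S I)}"
  have "\<F> = {F. F \<subseteq> {1..n} \<and> F \<in> fst ` C}"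
    using Ass_region_iff[OF valid fin irr nonempty, where 'k='k]
    unfolding \<F>_def assms(1) I by blast
  also have "\<dots> = fst ` C"
  proof -
    have "fst c \<in> Pow {1..n}" if "c \<in> C" for c using subsetD[OF valid that] by (simp add: mem_Times_iff)
    then show ?thesis by blast
  qed
  finally have \<F>: "\<F> = fst ` C" .
  have snd_C: "snd c = k (fst c)" if "c \<in> C" for c
    using that CA by (auto simp: A_def)
  have image: "(\<lambda>F. ideal_power S (monomial_prime n F) (k F)) ` \<F> = component n ` C"
    unfolding \<F> image_image using snd_C by (intro image_cong) (simp_all add: component_def assms(1))
  have pres: "I = carrier S \<inter> (\<Inter>F\<in>\<F>. ideal_power S (monomial_prime n F) (k F))"
    unfolding image using region_eq_Inter_components[OF valid, where 'k='k] I assms(1) by simp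
  have pos: "\<forall>F. F \<in> \<F> \<longrightarrow> 0 < k F"
  proof (intro allI impI)
    fix F assume "F \<in> \<F>"
    then obtain c where "c \<in> C" "F = fst c" unfolding \<F> by blast
    then show "0 < k F" using snd_C[of c] subsetD[OF valid, of c] by (simp add: mem_Times_iff)
  qed
  have unique: "\<D> = component n ` C" if D: "irredundant_presentation n I \<D>" for \<D>
  proof -
    obtain C' where C': "C' \<subseteq> Pow {1..n} \<times> {0<..}" "finite C'" "irredundant_constraints n C'"
      "I = monomial_span (region n C')" "\<D> = component n ` C'"
      using constraints_of_irredundant_presentation[OF D] .
    have "region n C' = region n C"
      using C'(4) unfolding I monomial_span_eq_iff by (rule sym)
    then have "C' = C"
      using irredundant_constraints_unique[OF C'(1) valid C'(2) fin C'(3) irr] nonempty by simp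
    with C'(5) show ?thesis by simp
  qed
  have "canonical_primary_decomposition n I ((\<lambda>F. ideal_power S (monomial_prime n F) (k F)) ` \<F>)"
    unfolding canonical_primary_decomposition_def image
    using irredundant_presentation_of_constraints[OF valid fin irr, where 'k='k] unique I by blast
  with pres pos show ?thesis unfolding \<F>_def k_def by blast
qed

end
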